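(* Let $r\geq 1$ be an integer and let $x$ be a formal variable. Then \[ \sum_{T} \; \prod_{v \in T} \big(x\, h_T(v) + 1 \big) = (x+1) \prod_{i=1}^{r-1} (r x + i), \] where the sum runs over all unordered increasing trees $T$ with $r$ vertices, the product on the left runs over all vertices $v$ of $T$ (including the root), and $h_T(v)$ is the size of the hook of $v$ in $T$.
   Context: A rooted tree is a tree (acyclic connected graph) with a distinguished vertex, the root. Each edge joins a father (the endpoint closer to the root) to a son (the endpoint farther from the root). The descendants of a vertex are its sons and, recursively, the descendants of its sons. The hook of a vertex $v$ in $T$ is the set consisting of $v$ and all its descendants, and $h_T(v)$ is its cardinality. An unordered increasing tree with $r$ vertices is a rooted tree whose vertices are labelled by $1,\dots,r$ (each label used exactly once) such that the label of a son is always bigger than the label of its father (so the root has label $1$), and where the sons of a given vertex are not ordered. Thus such a tree is determined by its father function $f:\{2,\dots,r\}\to\{1,\dots,r\}$ with $f(v)<v$ for all $v$. An empty product is $1$. *)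

theory Defs
  imports "HOL-Computational_Algebra.Polynomial"
begin

text \<open>A simple graph on a vertex set \<open>V\<close> is given by its set \<open>E\<close> of edges, each edge being a
  two-element subset of \<open>V\<close>.\<close>

definition adj :: "'a set set \<Rightarrow> ('a \<times> 'a) set" where
  "adj E = {(u, v). {u, v} \<in> E}"

definition simple_graph :: "'a set \<Rightarrow> 'a set set \<Rightarrow> bool" where
  "simple_graph V E \<longleftrightarrow> (\<forall>e\<in>E. e \<subseteq> V \<and> card e = 2)"

definition connected_graph :: "'a set \<Rightarrow> 'a set set \<Rightarrow> bool" where
  "connected_graph V E \<longleftrightarrow> (\<forall>u\<in>V. \<forall>v\<in>V. (u, v) \<in> (adj E)\<^sup>*)"

definition cycle :: "'a set set \<Rightarrow> 'a list \<Rightarrow> bool" where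
  "cycle E vs \<longleftrightarrow> 3 \<le> length vs \<and> distinct vs \<and>
     (\<forall>i<length vs. {vs ! i, vs ! (Suc i mod length vs)} \<in> E)"

definition acyclic_graph :: "'a set set \<Rightarrow> bool" where
  "acyclic_graph E \<longleftrightarrow> \<not> (\<exists>vs. cycle E vs)"

definition tree :: "'a set \<Rightarrow> 'a set set \<Rightarrow> bool" where
  "tree V E \<longleftrightarrow> simple_graph V E \<and> connected_graph V E \<and> acyclic_graph E"

definition graph_dist :: "'a set set \<Rightarrow> 'a \<Rightarrow> 'a \<Rightarrow> nat" where
  "graph_dist E u v = (LEAST n. (u, v) \<in> adj E ^^ n)"

text \<open>In the definitions below a rooted tree is a pair \<open>(E, \<rho>)\<close> of an edge set and a root.\<close>

definition rooted_tree :: "'a set \<Rightarrow> 'a set set \<times> 'a \<Rightarrow> bool" where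
  "rooted_tree V = (\<lambda>(E, \<rho>). tree V E \<and> \<rho> \<in> V)"

text \<open>The pairs (father, son).\<close>

definition father_son :: "'a set set \<times> 'a \<Rightarrow> ('a \<times> 'a) set" where
  "father_son = (\<lambda>(E, \<rho>). {(u, v). {u, v} \<in> E \<and> graph_dist E \<rho> u < graph_dist E \<rho> v})"

definition descendants :: "'a set set \<times> 'a \<Rightarrow> 'a \<Rightarrow> 'a set" where
  "descendants T v = {w. (v, w) \<in> (father_son T)\<^sup>+}"

definition hook :: "'a set set \<times> 'a \<Rightarrow> 'a \<Rightarrow> 'a set" where
  "hook T v = insert v (descendants T v)"

definition hook_size :: "'a set set \<times> 'a \<Rightarrow> 'a \<Rightarrow> nat" where
  "hook_size T v = card (hook T v)"

text \<open>Vertices are identified with their labels. The root is not required to be \<open>1\<close>: this is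
  forced by the condition on the labels.\<close>

definition increasing_trees :: "nat \<Rightarrow> (nat set set \<times> nat) set" where
  "increasing_trees r = {T. rooted_tree {1..r} T \<and> (\<forall>(u, v)\<in>father_son T. u < v)}"

abbreviation polyX :: "int poly" where
  "polyX \<equiv> [:0, 1:]"

end

theory Submission
  imports Defs "HOL-Library.FuncSet"
begin

text \<open>Give every vertex \<open>v\<close> a weight \<open>y\<^sub>v\<close> and replace the hook size by the total weight of the hook.
  Deleting the leaf \<open>r\<close>, attached to \<open>u\<close>, has the same effect on the remaining hook weights as
  adding \<open>y\<^sub>r\<close> to \<open>y\<^sub>u\<close>; induction on \<open>r\<close> and a telescoping sum over \<open>u\<close> then give the
  product \<open>(y\<^sub>r + 1) * (\<Prod>i<r. i * y\<^sub>i + y\<^sub>i\<^sub>+\<^sub>1 + \<dots> + y\<^sub>r + i)\<close>, and the claim is the case of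
  equal weights.\<close>

section \<open>Father functions and their extension by one vertex\<close>

text \<open>The extensional \<open>PiE\<close> fixes the values outside \<open>{2..r}\<close>, so
  that distinct father functions give distinct trees.\<close>

definition father_functions :: "nat \<Rightarrow> (nat \<Rightarrow> nat) set" where
  "father_functions r = (\<Pi>\<^sub>E v\<in>{2..r}. {1..<v})"

definition edges_of :: "nat \<Rightarrow> (nat \<Rightarrow> nat) \<Rightarrow> nat set set" where
  "edges_of r f = (\<lambda>v. {f v, v}) ` {2..r}"

text \<open>The edges directed from father to son: hooks become images under the closure of this
  relation, with no distances involved.\<close>

definition pairs_of :: "nat \<Rightarrow> (nat \<Rightarrow> nat) \<Rightarrow> (nat \<times> nat) set" where
  "pairs_of r f = (\<lambda>v. (f v, v)) ` {2..r}"

lemma father_functions_bounds: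
  assumes "f \<in> father_functions r" "v \<in> {2..r}"
  shows "1 \<le> f v" "f v < v"
  using assms by (auto simp: father_functions_def PiE_iff)

lemma father_functions_Suc:
  assumes "r \<ge> 1"
  shows "father_functions (Suc r) = (\<lambda>(u, f). f(Suc r := u)) ` ({1..r} \<times> father_functions r)"
proof -
  have "{2..Suc r} = insert (Suc r) {2..r}"
    using assms by auto
  then show ?thesis
    by (simp add: father_functions_def PiE_insert_eq atLeastLessThanSuc_atLeastAtMost)
qed

lemma inj_on_father_functions_extend:
  "inj_on (\<lambda>(u, f). f(Suc r := u)) ({1..r} \<times> father_functions r)"
proof -
  have "father_functions r = (\<Pi>\<^sub>E v\<in>{2..r}. {1..<v})"
    by (rule father_functions_def)
  \<comment> \<open>\<open>inj_combinator\<close> takes one family of ranges that also covers the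
    new index, so the family is patched at \<open>Suc r\<close>, which lies outside
    \<open>{2..r}\<close>.\<close>
  also have "\<dots> = (\<Pi>\<^sub>E v\<in>{2..r}. if v = Suc r then {1..r} else {1..<v})"
    by (rule PiE_cong) auto
  finally show ?thesis
    using inj_combinator[of "Suc r" "{2..r}" "\<lambda>v. if v = Suc r then {1..r} else {1..<v}"]
    by simp
qed


section \<open>Increasing trees as father functions\<close>

lemma adj_commute: "(u, v) \<in> adj E \<longleftrightarrow> (v, u) \<in> adj E"
  by (simp add: adj_def insert_commute)

lemma sym_adj: "sym (adj E)"
  by (rule symI) (simp add: adj_commute)

lemma adj_edges_of_iff:
  "(u, v) \<in> adj (edges_of r f) \<longleftrightarrow> (v \<in> {2..r} \<and> u = f v) \<or> (u \<in> {2..r} \<and> v = f u)"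
  by (auto simp: adj_def edges_of_def doubleton_eq_iff)

text \<open>Passing to fathers lowers the label until \<open>1\<close> is reached; symmetry of
  adjacency then joins any two vertices through \<open>1\<close>.\<close>

lemma connected_edges_of:
  assumes "\<And>v. v \<in> {2..r} \<Longrightarrow> 1 \<le> f v \<and> f v < v"
  shows "connected_graph {1..r} (edges_of r f)"
proof -
  have root: "(1, v) \<in> (adj (edges_of r f))\<^sup>*" if "v \<in> {1..r}" for v
    using that
  proof (induction v rule: less_induct)
    case (less v)
    show ?case
    proof (cases "v = 1")
      case False
      then have v: "v \<in> {2..r}"
        using less.prems by auto
      then have "(1, f v) \<in> (adj (edges_of r f))\<^sup>*"
        using assms[OF v] by (intro less.IH) auto
      moreover have "(f v, v) \<in> adj (edges_of r f)"
        using v by (simp add: adj_edges_of_iff)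
      ultimately show ?thesis
        by (rule rtrancl_into_rtrancl)
    qed simp
  qed
  have "sym ((adj (edges_of r f))\<^sup>*)"
    by (rule sym_rtrancl[OF sym_adj])
  then show ?thesis
    using root unfolding connected_graph_def by (meson rtrancl_trans symD)
qed

text \<open>The largest vertex of a cycle would have two distinct smaller neighbours, but its only
  smaller neighbour is its father.\<close>

lemma acyclic_edges_of:
  assumes "\<And>v. v \<in> {2..r} \<Longrightarrow> f v < v"
  shows "acyclic_graph (edges_of r f)"
  unfolding acyclic_graph_def
proof
  assume "\<exists>vs. cycle (edges_of r f) vs"
  then obtain vs where len: "3 \<le> length vs" and dist: "distinct vs"
    and edge: "\<And>i. i < length vs \<Longrightarrow> (vs ! i, vs ! (Suc i mod length vs)) \<in> adj (edges_of r f)"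
    by (auto simp: cycle_def adj_def)
  define n where "n = length vs"
  have n: "3 \<le> n"
    using len by (simp add: n_def)
  have "Max (set vs) \<in> set vs"
    using len by (intro Max_in) auto
  then obtain i where i: "i < n" "vs ! i = Max (set vs)"
    by (auto simp: in_set_conv_nth n_def)
  \<comment> \<open>\<open>j\<close> and \<open>k\<close> are the cyclic neighbours of position
    \<open>i\<close>; they differ because the cycle has at least three vertices.\<close>
  define j where "j = (if i = 0 then n - 1 else i - 1)"
  define k where "k = (if Suc i = n then 0 else Suc i)"
  have jk: "j < n" "k < n" "j \<noteq> k" "Suc j mod n = i" "Suc i mod n = k"
    using n i(1) by (auto simp: j_def k_def split: if_splits)
  have le: "vs ! l \<le> vs ! i" if "l < n" for l
    using that i(2) by (simp add: n_def)
  have father: "w = f (vs ! i)" if "(w, vs ! i) \<in> adj (edges_of r f)" "w \<le> vs ! i" for w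
    using that assms by (fastforce simp: adj_edges_of_iff)
  have "vs ! j = f (vs ! i)"
    using edge[of j] jk le[of j] by (intro father) (simp_all add: n_def)
  moreover have "vs ! k = f (vs ! i)"
    using edge[of i] i(1) jk le[of k] by (intro father) (simp_all add: n_def adj_commute)
  ultimately have "vs ! j = vs ! k"
    by simp
  then show False
    using dist jk(1-3) by (simp add: n_def nth_eq_iff_index_eq)
qed

section \<open>Distances from the root orient the edges\<close>

text \<open>The last step of a walk to \<open>v\<close> comes from the father or from a son of
  \<open>v\<close>. For a son \<open>w\<close>, induction gives a shorter walk to
  \<open>f w = v\<close>, and the induction hypothesis applies once more to that walk.\<close>

lemma relpow_to_father:
  assumes "v \<in> {2..r}" "(1, v) \<in> adj (edges_of r f) ^^ n"
  shows "\<exists>m<n. (1, f v) \<in> adj (edges_of r f) ^^ m"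
  using assms
proof (induction n arbitrary: v rule: less_induct)
  case (less n)
  show ?case
  proof (cases n)
    case 0
    then show ?thesis using less.prems by simp
  next
    case (Suc k)
    then obtain w where w: "(1, w) \<in> adj (edges_of r f) ^^ k" "(w, v) \<in> adj (edges_of r f)"
      using less.prems by auto
    from w(2) consider "w = f v" | "w \<in> {2..r}" "v = f w"
      by (auto simp: adj_edges_of_iff)
    then show ?thesis
    proof cases
      case 1
      then show ?thesis using w Suc by auto
    next
      case 2
      then obtain m where "m < k" "(1, v) \<in> adj (edges_of r f) ^^ m"
        using less.IH[of k w] w Suc by auto
      then obtain l where "l < m" "(1, f v) \<in> adj (edges_of r f) ^^ l"
        using less.IH[of m v] less.prems Suc by auto
      then show ?thesis
        using \<open>m < k\<close> Suc by (intro exI[of _ l]) auto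
    qed
  qed
qed

lemma relpow_graph_dist:
  assumes "(u, v) \<in> (adj E)\<^sup>*"
  shows "(u, v) \<in> adj E ^^ graph_dist E u v"
  using assms unfolding graph_dist_def by (metis LeastI rtrancl_imp_relpow)

lemma graph_dist_le: "(u, v) \<in> adj E ^^ n \<Longrightarrow> graph_dist E u v \<le> n"
  unfolding graph_dist_def by (rule Least_le)

text \<open>A shortest walk to \<open>v\<close> yields a strictly shorter one to \<open>f v\<close>,
  so orienting edges by distance agrees with orienting them by \<open>f\<close>.\<close>

lemma father_son_edges_of:
  assumes f: "\<And>v. v \<in> {2..r} \<Longrightarrow> 1 \<le> f v \<and> f v < v"
  shows "father_son (edges_of r f, 1) = pairs_of r f"
proof -
  have lt: "graph_dist (edges_of r f) 1 (f v) < graph_dist (edges_of r f) 1 v" if v: "v \<in> {2..r}" for v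
  proof -
    have "(1, v) \<in> (adj (edges_of r f))\<^sup>*"
      using connected_edges_of[OF f] v by (auto simp: connected_graph_def)
    then show ?thesis
      using relpow_to_father[OF v relpow_graph_dist] graph_dist_le by (meson le_less_trans)
  qed
  have "(u, v) \<in> father_son (edges_of r f, 1) \<longleftrightarrow> (u, v) \<in> pairs_of r f" for u v
  proof -
    have "(u, v) \<in> father_son (edges_of r f, 1) \<longleftrightarrow>
        (u, v) \<in> adj (edges_of r f) \<and> graph_dist (edges_of r f) 1 u < graph_dist (edges_of r f) 1 v"
      by (simp add: father_son_def adj_def)
    also have "\<dots> \<longleftrightarrow> v \<in> {2..r} \<and> u = f v"
      unfolding adj_edges_of_iff using lt[of u] lt[of v] by auto
    also have "\<dots> \<longleftrightarrow> (u, v) \<in> pairs_of r f"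
      by (auto simp: pairs_of_def)
    finally show ?thesis .
  qed
  then show ?thesis
    by auto
qed

lemma edges_of_increasing_tree:
  assumes "r \<ge> 1" "f \<in> father_functions r"
  shows "(edges_of r f, 1) \<in> increasing_trees r"
proof -
  have f: "1 \<le> f v \<and> f v < v" if "v \<in> {2..r}" for v
    using father_functions_bounds[OF assms(2) that] by simp
  have "simple_graph {1..r} (edges_of r f)"
    using f by (fastforce simp: simple_graph_def edges_of_def)
  moreover have "\<forall>(u, v)\<in>father_son (edges_of r f, 1). u < v"
    using f father_son_edges_of[of r f] by (auto simp: pairs_of_def simp del: One_nat_def)
  ultimately show ?thesis
    using assms(1) connected_edges_of[OF f] acyclic_edges_of[of r f] f
    by (simp add: increasing_trees_def rooted_tree_def tree_def)
qed

section \<open>Every increasing tree comes from a father function\<close>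

text \<open>Cycles need distinct vertices, so a path that returns to an earlier vertex is cut back
  to its visit there.\<close>

lemma rtrancl_distinct_path:
  assumes "(a, b) \<in> R\<^sup>*"
  shows "\<exists>xs. xs \<noteq> [] \<and> hd xs = a \<and> last xs = b \<and> distinct xs \<and>
    (\<forall>i. Suc i < length xs \<longrightarrow> (xs ! i, xs ! Suc i) \<in> R)"
  using assms
proof (induction rule: rtrancl_induct)
  case base
  show ?case
    by (rule exI[of _ "[a]"]) simp
next
  case (step y z)
  then obtain xs where xs: "xs \<noteq> []" "hd xs = a" "last xs = y" "distinct xs"
    "\<And>i. Suc i < length xs \<Longrightarrow> (xs ! i, xs ! Suc i) \<in> R"
    by blast
  show ?case
  proof (cases "z \<in> set xs")
    case True
    then obtain ys zs where split: "xs = ys @ z # zs"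
      by (auto simp: in_set_conv_decomp)
    have "((ys @ [z]) ! i, (ys @ [z]) ! Suc i) \<in> R" if "Suc i < length (ys @ [z])" for i
      using xs(5)[of i] that by (auto simp: split nth_append split: if_splits)
    then show ?thesis
      using xs(2,4) split by (intro exI[of _ "ys @ [z]"]) (auto simp: hd_append)
  next
    case False
    have "((xs @ [z]) ! i, (xs @ [z]) ! Suc i) \<in> R" if "Suc i < length (xs @ [z])" for i
    proof (cases "Suc i < length xs")
      case True
      then show ?thesis
        using xs(5)[of i] by (simp add: nth_append)
    next
      case False
      then have "i = length xs - 1"
        using that by simp
      then show ?thesis
        using xs(1,3) step.hyps(2) by (simp add: nth_append last_conv_nth)
    qed
    then show ?thesis
      using xs False by (intro exI[of _ "xs @ [z]"]) auto
  qed
qed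

text \<open>An edge outside a connected subgraph closes a path of that subgraph to a cycle.\<close>

lemma acyclic_connected_subgraph_eq:
  assumes "simple_graph V E" "acyclic_graph E" "E' \<subseteq> E" "connected_graph V E'"
  shows "E' = E"
proof (rule ccontr)
  assume "E' \<noteq> E"
  then obtain e where e: "e \<in> E" "e \<notin> E'"
    using assms(3) by auto
  then obtain a b where ab: "e = {a, b}" "a \<noteq> b" "a \<in> V" "b \<in> V"
    using assms(1) by (fastforce simp: simple_graph_def card_2_iff)
  then have "(a, b) \<in> (adj E')\<^sup>*"
    using assms(4) by (simp add: connected_graph_def)
  then obtain xs where xs: "xs \<noteq> []" "hd xs = a" "last xs = b" "distinct xs"
    "\<And>i. Suc i < length xs \<Longrightarrow> (xs ! i, xs ! Suc i) \<in> adj E'"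
    using rtrancl_distinct_path by metis
  have ends: "xs ! 0 = a" "xs ! (length xs - 1) = b"
    using xs(1-3) by (simp_all add: hd_conv_nth last_conv_nth)
  \<comment> \<open>One vertex would give \<open>a = b\<close>; two would put the missing edge
    \<open>e\<close> into \<open>E'\<close>.\<close>
  have "length xs \<noteq> 1"
    using ends ab(2) by auto
  moreover have "length xs \<noteq> 2"
    using xs(5)[of 0] ends e(2) ab(1) by (auto simp: adj_def)
  ultimately have "3 \<le> length xs"
    using xs(1) by (cases "length xs") auto
  moreover have "{xs ! i, xs ! (Suc i mod length xs)} \<in> E" if "i < length xs" for i
  proof (cases "Suc i = length xs")
    case True
    then have "i = length xs - 1"
      by simp
    then show ?thesis
      using True ends e(1) ab(1) by (simp add: insert_commute)
  next
    case False
    then show ?thesis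
      using that xs(5)[of i] assms(3) by (auto simp: adj_def)
  qed
  ultimately have "cycle E xs"
    using xs(4) by (simp add: cycle_def)
  then show False
    using assms(2) by (auto simp: acyclic_graph_def)
qed

text \<open>The last step of a shortest walk from the root starts at a father. Choosing fathers
  gives a connected subgraph of the acyclic \<open>E\<close>, hence all of \<open>E\<close>.\<close>

lemma increasing_tree_is_edges_of:
  assumes "T \<in> increasing_trees r"
  shows "\<exists>f\<in>father_functions r. T = (edges_of r f, 1)"
proof -
  obtain E \<rho> where T: "T = (E, \<rho>)"
    by (cases T)
  have simp: "simple_graph {1..r} E" and con: "connected_graph {1..r} E"
    and acyc: "acyclic_graph E" and \<rho>: "\<rho> \<in> {1..r}"
    and inc: "\<And>u v. (u, v) \<in> father_son (E, \<rho>) \<Longrightarrow> u < v"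
    using assms by (auto simp: T increasing_trees_def rooted_tree_def tree_def)
  have father: "\<exists>u. u \<in> {1..<v} \<and> {u, v} \<in> E" if v: "v \<in> {1..r}" "v \<noteq> \<rho>" for v
  proof -
    have path: "(\<rho>, v) \<in> adj E ^^ graph_dist E \<rho> v"
      using con v \<rho> by (intro relpow_graph_dist) (simp add: connected_graph_def)
    then obtain k where k: "graph_dist E \<rho> v = Suc k"
      using v(2) by (cases "graph_dist E \<rho> v") auto
    then obtain u where u: "(\<rho>, u) \<in> adj E ^^ k" "{u, v} \<in> E"
      using path by (auto simp: adj_def)
    then have "(u, v) \<in> father_son (E, \<rho>)"
      using graph_dist_le[OF u(1)] k by (simp add: father_son_def)
    then have "u < v"
      by (rule inc)
    moreover have "u \<ge> 1"
      using simp u(2) by (auto simp: simple_graph_def)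
    ultimately show ?thesis
      using u(2) by auto
  qed
  \<comment> \<open>Otherwise the vertex \<open>1\<close> would have a father in the empty range
    \<open>{1..<1}\<close>.\<close>
  have root: "\<rho> = 1"
    using father[of 1] \<rho> by auto
  define f where "f = restrict (\<lambda>v. SOME u. u \<in> {1..<v} \<and> {u, v} \<in> E) {2..r}"
  have f: "f v \<in> {1..<v} \<and> {f v, v} \<in> E" if "v \<in> {2..r}" for v
    using someI_ex[OF father[of v]] that root by (simp add: f_def)
  have "f \<in> father_functions r"
    using f by (auto simp: father_functions_def f_def)
  moreover have "edges_of r f = E"
    using f
    by (intro acyclic_connected_subgraph_eq[OF simp acyc] connected_edges_of)
      (auto simp: edges_of_def)
  ultimately show ?thesis
    using T root by auto
qed

lemma increasing_trees_eq:
  assumes "r \<ge> 1"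
  shows "increasing_trees r = (\<lambda>f. (edges_of r f, 1)) ` father_functions r"
  using edges_of_increasing_tree[OF assms] increasing_tree_is_edges_of by blast

text \<open>The father-son relation of the tree recovers \<open>f\<close> on \<open>{2..r}\<close>,
  and extensionality settles the other values.\<close>

lemma inj_on_edges_of: "inj_on (\<lambda>f. (edges_of r f, 1::nat)) (father_functions r)"
proof (rule inj_onI)
  fix f g
  assume f: "f \<in> father_functions r" and g: "g \<in> father_functions r"
    and "(edges_of r f, 1::nat) = (edges_of r g, 1)"
  then have "pairs_of r f = pairs_of r g"
    using father_son_edges_of father_functions_bounds by metis
  then have "f v = g v" if "v \<in> {2..r}" for v
    using that by (auto simp: pairs_of_def)
  then show "f = g"
    using f g unfolding father_functions_def by (rule PiE_ext[rotated 2]) auto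
qed

lemma hook_edges_of:
  assumes "f \<in> father_functions r"
  shows "hook (edges_of r f, 1) v = (pairs_of r f)\<^sup>* `` {v}"
  using father_son_edges_of[of r f] father_functions_bounds[OF assms]
  by (auto simp: hook_def descendants_def rtrancl_eq_or_trancl)


section \<open>The weighted identity\<close>

lemma rtrancl_pairs_of_image:
  assumes "f \<in> father_functions r" "v \<in> {1..r}"
  shows "(pairs_of r f)\<^sup>* `` {v} \<subseteq> {1..r}"
proof -
  have "w \<in> {1..r}" if "(v, w) \<in> (pairs_of r f)\<^sup>*" for w
    using that assms(2) by (induction rule: rtrancl_induct) (auto simp: pairs_of_def)
  then show ?thesis
    by auto
qed

text \<open>The new vertex is a leaf entered only from \<open>u\<close>, so it joins exactly the
  hooks that contain \<open>u\<close>.\<close>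

lemma rtrancl_pairs_of_extend:
  assumes f: "f \<in> father_functions r" and u: "u \<in> {1..r}" and v: "v \<in> {1..r}"
  shows "(pairs_of (Suc r) (f(Suc r := u)))\<^sup>* `` {v} =
    (pairs_of r f)\<^sup>* `` {v} \<union> (if u \<in> (pairs_of r f)\<^sup>* `` {v} then {Suc r} else {})"
    and "(pairs_of (Suc r) (f(Suc r := u)))\<^sup>* `` {Suc r} = {Suc r}"
proof -
  have "{2..Suc r} = insert (Suc r) {2..r}"
    using u by auto
  then have pairs: "pairs_of (Suc r) (f(Suc r := u)) = insert (u, Suc r) (pairs_of r f)"
    by (auto simp: pairs_of_def)
  have last: "w = Suc r" if "(Suc r, w) \<in> (pairs_of r f)\<^sup>*" for w
    using that father_functions_bounds(2)[OF f]
    by (induction rule: rtrancl_induct) (fastforce simp: pairs_of_def)+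
  show "(pairs_of (Suc r) (f(Suc r := u)))\<^sup>* `` {v} =
    (pairs_of r f)\<^sup>* `` {v} \<union> (if u \<in> (pairs_of r f)\<^sup>* `` {v} then {Suc r} else {})"
    unfolding pairs rtrancl_insert using last by auto
  show "(pairs_of (Suc r) (f(Suc r := u)))\<^sup>* `` {Suc r} = {Suc r}"
    unfolding pairs rtrancl_insert using last by auto
qed

definition hook_weight ::
    "(nat \<Rightarrow> 'a::comm_semiring_1) \<Rightarrow> nat \<Rightarrow> (nat \<Rightarrow> nat) \<Rightarrow> nat \<Rightarrow> 'a" where
  "hook_weight y r f v = sum y ((pairs_of r f)\<^sup>* `` {v})"

lemma sum_fun_upd_add:
  fixes y :: "'b \<Rightarrow> 'a::comm_monoid_add"
  assumes "finite A"
  shows "sum (y(u := y u + z)) A = sum y A + (if u \<in> A then z else 0)"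
proof -
  have "sum (y(u := y u + z)) A = (\<Sum>w\<in>A. y w + (if w = u then z else 0))"
    by (rule sum.cong) auto
  then show ?thesis
    using assms by (simp add: sum.distrib)
qed

lemma hook_weight_extend:
  assumes "f \<in> father_functions r" "u \<in> {1..r}"
  shows "v \<in> {1..r} \<Longrightarrow> hook_weight y (Suc r) (f(Suc r := u)) v =
      hook_weight (y(u := y u + y (Suc r))) r f v"
    and "hook_weight y (Suc r) (f(Suc r := u)) (Suc r) = y (Suc r)"
proof -
  assume v: "v \<in> {1..r}"
  let ?H = "(pairs_of r f)\<^sup>* `` {v}"
  have sub: "?H \<subseteq> {1..r}"
    by (rule rtrancl_pairs_of_image[OF assms(1) v])
  then have "finite ?H" "Suc r \<notin> ?H"
    using finite_subset by auto
  then show "hook_weight y (Suc r) (f(Suc r := u)) v = hook_weight (y(u := y u + y (Suc r))) r f v"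
    unfolding hook_weight_def rtrancl_pairs_of_extend(1)[OF assms v]
    using sum_fun_upd_add[of ?H y u "y (Suc r)"] by (simp add: add.commute del: fun_upd_apply)
next
  show "hook_weight y (Suc r) (f(Suc r := u)) (Suc r) = y (Suc r)"
    using rtrancl_pairs_of_extend(2)[OF assms assms(2)] by (simp add: hook_weight_def)
qed

section \<open>Summing over the father of the new leaf\<close>

text \<open>With \<open>D u\<close> equal to \<open>u\<close> times the product of
  \<open>A i + z\<close> for \<open>i \<le> u\<close> and of \<open>A i\<close> for
  \<open>i > u\<close>, the summand is \<open>D u - D (u - 1)\<close>. A semiring has no
  subtraction, so induction on \<open>k\<close> does the telescoping.\<close>

lemma telescoping_sum_of_products:
  fixes A :: "nat \<Rightarrow> 'a::comm_semiring_1"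
  shows "(\<Sum>u\<in>{1..k}. (\<Prod>i\<in>{1..<u}. A i + z) * (A u + of_nat u * z) * (\<Prod>i\<in>{u<..k}. A i)) =
    of_nat k * (\<Prod>i\<in>{1..k}. A i + z)"
proof (induction k)
  case (Suc k)
  let ?t = "\<lambda>k u. (\<Prod>i\<in>{1..<u}. A i + z) * (A u + of_nat u * z) * (\<Prod>i\<in>{u<..k}. A i)"
  have "?t (Suc k) u = ?t k u * A (Suc k)" if "u \<in> {1..k}" for u
  proof -
    have "{u<..Suc k} = insert (Suc k) {u<..k}"
      using that by auto
    then show ?thesis
      by (simp add: ac_simps)
  qed
  then have "(\<Sum>u\<in>{1..k}. ?t (Suc k) u) = (\<Sum>u\<in>{1..k}. ?t k u) * A (Suc k)"
    by (simp add: sum_distrib_right)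
  moreover have "(\<Sum>u\<in>{1..Suc k}. ?t (Suc k) u) = (\<Sum>u\<in>{1..k}. ?t (Suc k) u) + ?t (Suc k) (Suc k)"
    by simp
  ultimately have "(\<Sum>u\<in>{1..Suc k}. ?t (Suc k) u) =
      of_nat k * (\<Prod>i\<in>{1..k}. A i + z) * A (Suc k)
      + (\<Prod>i\<in>{1..k}. A i + z) * (A (Suc k) + of_nat (Suc k) * z)"
    by (simp only: Suc.IH) (simp add: atLeastLessThanSuc_atLeastAtMost)
  \<comment> \<open>With \<open>a = A (Suc k)\<close> this is
    \<open>k * a + (a + (k + 1) * z) = (k + 1) * (a + z)\<close>.\<close>
  also have "\<dots> = of_nat (Suc k) * (\<Prod>i\<in>{1..Suc k}. A i + z)"
    by (simp add: algebra_simps)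
  finally show ?case .
qed simp

text \<open>For the constant weight \<open>x\<close> and \<open>i \<le> r\<close> this is
  \<open>r * x + i\<close>.\<close>

definition hook_factor :: "(nat \<Rightarrow> 'a::comm_semiring_1) \<Rightarrow> nat \<Rightarrow> nat \<Rightarrow> 'a" where
  "hook_factor y r i = of_nat i * y i + sum y {i<..r} + of_nat i"

text \<open>The weight of \<open>u\<close> enters the tail sum if \<open>i < u\<close>, the term
  \<open>i * y i\<close> if \<open>i = u\<close>, and neither if \<open>i > u\<close>.\<close>

lemma hook_factor_fun_upd:
  assumes "u \<le> r"
  shows "hook_factor (y(u := y u + z)) r i =
    hook_factor y r i + (if i < u then z else if i = u then of_nat u * z else 0)"
  using assms sum_fun_upd_add[of "{i<..r}" y u z]
  by (auto simp: hook_factor_def algebra_simps simp del: fun_upd_apply simp: fun_upd_same fun_upd_other)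

text \<open>Write \<open>B = y (Suc k) + 1\<close> and \<open>P\<close> for the product on the
  right. For \<open>u \<le> k\<close> the summands are \<open>B\<close> times the telescoping ones
  and add up to \<open>B * k * P\<close>; \<open>u = Suc k\<close> changes \<open>B\<close> to
  \<open>B + z\<close> and every other factor by \<open>z\<close>, giving
  \<open>(B + z) * P\<close>.\<close>

lemma sum_hook_products_step:
  fixes y :: "nat \<Rightarrow> 'a::comm_semiring_1" and k :: nat and z :: 'a
  defines "y' \<equiv> \<lambda>u. y(u := y u + z)"
  shows "(\<Sum>u\<in>{1..Suc k}. (y' u (Suc k) + 1) * (\<Prod>i\<in>{1..k}. hook_factor (y' u) (Suc k) i)) =
    (\<Prod>i\<in>{1..k}. hook_factor y (Suc k) i + z) * (of_nat (Suc k) * (y (Suc k) + 1) + z)"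
proof -
  let ?A = "hook_factor y (Suc k)" and ?B = "y (Suc k) + 1"
  have "(y' u (Suc k) + 1) * (\<Prod>i\<in>{1..k}. hook_factor (y' u) (Suc k) i) =
      ?B * ((\<Prod>i\<in>{1..<u}. ?A i + z) * (?A u + of_nat u * z) * (\<Prod>i\<in>{u<..k}. ?A i))"
    if u: "u \<in> {1..k}" for u
  proof -
    have split: "{1..k} = {1..<u} \<union> insert u {u<..k}"
      using u by auto
    have "(\<Prod>i\<in>{1..k}. hook_factor (y' u) (Suc k) i) =
        (\<Prod>i\<in>{1..<u}. hook_factor (y' u) (Suc k) i) *
        (hook_factor (y' u) (Suc k) u * (\<Prod>i\<in>{u<..k}. hook_factor (y' u) (Suc k) i))"
      unfolding split by (subst prod.union_disjoint) auto
    then show ?thesis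
      using u by (simp add: y'_def hook_factor_fun_upd mult.assoc)
  qed
  then have "(\<Sum>u\<in>{1..k}. (y' u (Suc k) + 1) * (\<Prod>i\<in>{1..k}. hook_factor (y' u) (Suc k) i)) =
      ?B * (of_nat k * (\<Prod>i\<in>{1..k}. ?A i + z))"
    by (simp only: telescoping_sum_of_products[symmetric] sum_distrib_left cong: sum.cong)
  moreover have "(\<Prod>i\<in>{1..k}. hook_factor (y' (Suc k)) (Suc k) i) = (\<Prod>i\<in>{1..k}. ?A i + z)"
    by (rule prod.cong) (auto simp: y'_def hook_factor_fun_upd)
  moreover have "y' (Suc k) (Suc k) = y (Suc k) + z"
    by (simp add: y'_def)
  ultimately show ?thesis
    by (simp add: algebra_simps)
qed

section \<open>Induction on the number of vertices and equal weights\<close>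

text \<open>The weights stay arbitrary in the induction because the hypothesis is applied to
  different weights for each father \<open>u\<close> of the last vertex.\<close>

lemma sum_weighted_hook_products:
  fixes y :: "nat \<Rightarrow> 'a::comm_semiring_1"
  shows "(\<Sum>f\<in>father_functions (Suc k). \<Prod>v\<in>{1..Suc k}. hook_weight y (Suc k) f v + 1) =
    (y (Suc k) + 1) * (\<Prod>i\<in>{1..k}. hook_factor y (Suc k) i)"
proof (induction k arbitrary: y)
  case 0
  have "father_functions (Suc 0) = {\<lambda>_. undefined}"
    by (simp add: father_functions_def)
  then show ?case
    by (simp add: hook_weight_def pairs_of_def)
next
  case (Suc k)
  let ?r = "Suc k"
  let ?z = "y (Suc ?r)"
  let ?y = "\<lambda>u. y(u := y u + ?z)"
  have step: "(\<Prod>v\<in>{1..Suc ?r}. hook_weight y (Suc ?r) (f(Suc ?r := u)) v + 1) =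
      (?z + 1) * (\<Prod>v\<in>{1..?r}. hook_weight (?y u) ?r f v + 1)"
    if "u \<in> {1..?r}" "f \<in> father_functions ?r" for u f
  proof -
    have "(\<Prod>v\<in>{1..Suc ?r}. hook_weight y (Suc ?r) (f(Suc ?r := u)) v + 1) =
        (\<Prod>v\<in>{1..?r}. hook_weight y (Suc ?r) (f(Suc ?r := u)) v + 1) *
        (hook_weight y (Suc ?r) (f(Suc ?r := u)) (Suc ?r) + 1)"
      by (subst prod.nat_ivl_Suc') (simp_all add: mult.commute)
    then show ?thesis
      using hook_weight_extend[OF that(2,1), where y = y] by (simp add: mult.commute del: prod.cl_ivl_Suc)
  qed
  have "(\<Sum>f\<in>father_functions (Suc ?r). \<Prod>v\<in>{1..Suc ?r}. hook_weight y (Suc ?r) f v + 1) =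
      (\<Sum>(u, f)\<in>{1..?r} \<times> father_functions ?r.
        \<Prod>v\<in>{1..Suc ?r}. hook_weight y (Suc ?r) (f(Suc ?r := u)) v + 1)"
    by (subst father_functions_Suc, simp, subst sum.reindex[OF inj_on_father_functions_extend])
      (simp add: case_prod_unfold o_def)
  also have "\<dots> = (\<Sum>u\<in>{1..?r}. \<Sum>f\<in>father_functions ?r.
      (?z + 1) * (\<Prod>v\<in>{1..?r}. hook_weight (?y u) ?r f v + 1))"
    unfolding sum.cartesian_product[symmetric] by (intro sum.cong refl step)
  also have "\<dots> = (?z + 1) *
      (\<Sum>u\<in>{1..?r}. (?y u ?r + 1) * (\<Prod>i\<in>{1..k}. hook_factor (?y u) ?r i))"
    by (simp only: sum_distrib_left[symmetric] Suc.IH)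
  also have "\<dots> = (?z + 1) *
      ((\<Prod>i\<in>{1..k}. hook_factor y ?r i + ?z) * (of_nat ?r * (y ?r + 1) + ?z))"
    by (simp only: sum_hook_products_step)
  \<comment> \<open>Adding \<open>?z\<close> extends the tail sum of each factor by the last
    vertex.\<close>
  also have "(\<Prod>i\<in>{1..k}. hook_factor y ?r i + ?z) = (\<Prod>i\<in>{1..k}. hook_factor y (Suc ?r) i)"
  proof (rule prod.cong)
    fix i assume "i \<in> {1..k}"
    then have "{i<..Suc ?r} = insert (Suc ?r) {i<..?r}"
      by auto
    then show "hook_factor y ?r i + ?z = hook_factor y (Suc ?r) i"
      by (simp add: hook_factor_def ac_simps)
  qed simp
  \<comment> \<open>The remaining factor has index \<open>?r\<close>, where the tail sum is just
    \<open>?z\<close>.\<close>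
  also have "of_nat ?r * (y ?r + 1) + ?z = hook_factor y (Suc ?r) ?r"
  proof -
    have "{?r<..Suc ?r} = {Suc ?r}"
      by auto
    then show ?thesis
      by (simp add: hook_factor_def algebra_simps)
  qed
  also have "(\<Prod>i\<in>{1..k}. hook_factor y (Suc ?r) i) * hook_factor y (Suc ?r) ?r =
      (\<Prod>i\<in>{1..?r}. hook_factor y (Suc ?r) i)"
    by simp
  finally show ?case .
qed

theorem mainTheorem2:
  fixes r :: nat
  assumes "r \<ge> 1"
  shows "(\<Sum>T\<in>increasing_trees r. \<Prod>v\<in>{1..r}. (polyX * of_nat (hook_size T v) + 1)) =
         (polyX + 1) * (\<Prod>i\<in>{1..r - 1}. (of_nat r * polyX + of_nat i))"
proof -
  obtain k where k: "r = Suc k"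
    using assms by (cases r) auto
  have "(\<Sum>T\<in>increasing_trees r. \<Prod>v\<in>{1..r}. (polyX * of_nat (hook_size T v) + 1)) =
      (\<Sum>f\<in>father_functions r. \<Prod>v\<in>{1..r}. polyX * of_nat (hook_size (edges_of r f, 1) v) + 1)"
    unfolding increasing_trees_eq[OF assms] by (subst sum.reindex[OF inj_on_edges_of]) simp
  also have "\<dots> = (\<Sum>f\<in>father_functions r. \<Prod>v\<in>{1..r}. hook_weight (\<lambda>_. polyX) r f v + 1)"
    by (intro sum.cong prod.cong refl)
      (simp add: hook_size_def hook_edges_of hook_weight_def mult.commute del: One_nat_def)
  also have "\<dots> = (polyX + 1) * (\<Prod>i\<in>{1..k}. hook_factor (\<lambda>_. polyX) r i)"
    unfolding k by (rule sum_weighted_hook_products)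
  also have "(\<Prod>i\<in>{1..k}. hook_factor (\<lambda>_. polyX) r i) =
      (\<Prod>i\<in>{1..r - 1}. of_nat r * polyX + of_nat i)"
  proof (rule prod.cong)
    fix i assume "i \<in> {1..r - 1}"
    \<comment> \<open>Of the \<open>r\<close> copies of \<open>polyX\<close>, \<open>i\<close> come
      from the term \<open>i * y i\<close> and \<open>r - i\<close> from the tail sum.\<close>
    then have "of_nat r = (of_nat i + of_nat (r - i) :: int poly)"
      unfolding of_nat_add[symmetric] by (intro arg_cong[of _ _ of_nat]) auto
    then show "hook_factor (\<lambda>_. polyX) r i = of_nat r * polyX + of_nat i"
      unfolding hook_factor_def by (simp only: sum_constant card_greaterThanAtMost distrib_right)
  qed (simp add: k)
  finally show ?thesis .
qed

end
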